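(* For every $\beta > 0$ there exist $N=N(\beta)$ and $\delta=\delta(\beta)>0$ such that every graph $G$ with $n > N$ vertices and $m \ge \beta n^2$ edges satisfying $\tau_t(G) \ge (1-\delta)\frac{m}{2}$ also satisfies $$\tau_t^*(G) \ge \left(1+\frac{\beta^2}{800}\right)\frac{m}{4}.$$
   Context: All graphs are finite, simple and undirected. $\tau_t(G)$ is the minimum number of edges of $G$ whose removal leaves a triangle-free graph. A fractional triangle cover of $G$ is a function $f:E(G)\to[0,\infty)$ such that for every triangle of $G$ the sum of $f$ over its three edges is at least $1$; $\tau_t^*(G)$ is the minimum of $\sum_{e\in E(G)} f(e)$ over all fractional triangle covers $f$. *)

theory Defs
  imports "HOL-Analysis.Analysis"
begin

definition simple_graph :: "'a set \<Rightarrow> 'a set set \<Rightarrow> bool" where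
  "simple_graph V E \<longleftrightarrow> finite V \<and> (\<forall>e\<in>E. e \<subseteq> V \<and> card e = 2)"

definition is_triangle :: "'a set set \<Rightarrow> 'a \<Rightarrow> 'a \<Rightarrow> 'a \<Rightarrow> bool" where
  "is_triangle E x y z \<longleftrightarrow>
     x \<noteq> y \<and> y \<noteq> z \<and> x \<noteq> z \<and> {x, y} \<in> E \<and> {y, z} \<in> E \<and> {x, z} \<in> E"

definition triangle_free :: "'a set set \<Rightarrow> bool" where
  "triangle_free E \<longleftrightarrow> (\<nexists>x y z. is_triangle E x y z)"

definition tau_t :: "'a set set \<Rightarrow> nat" where
  "tau_t E = Min {card F | F. F \<subseteq> E \<and> triangle_free (E - F)}"

(* Values of f outside E are irrelevant. *)
definition fractional_triangle_cover :: "'a set set \<Rightarrow> ('a set \<Rightarrow> real) \<Rightarrow> bool" where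
  "fractional_triangle_cover E f \<longleftrightarrow>
     (\<forall>e\<in>E. 0 \<le> f e) \<and>
     (\<forall>x y z. is_triangle E x y z \<longrightarrow> f {x, y} + f {y, z} + f {x, z} \<ge> 1)"

(* The infimum is attained for finite E, see tau_t_star_attained below. *)
definition tau_t_star :: "'a set set \<Rightarrow> real" where
  "tau_t_star E = Inf {(\<Sum>e\<in>E. f e) | f. fractional_triangle_cover E f}"

lemma finite_edges: "simple_graph V E \<Longrightarrow> finite E"
  unfolding simple_graph_def by (meson PowI finite_Pow_iff finite_subset subsetI)

lemma tau_t_attained:
  assumes "finite E"
  obtains F where "F \<subseteq> E" "triangle_free (E - F)" "card F = tau_t E"
    "\<And>F'. F' \<subseteq> E \<Longrightarrow> triangle_free (E - F') \<Longrightarrow> tau_t E \<le> card F'"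
proof -
  let ?S = "{card F | F. F \<subseteq> E \<and> triangle_free (E - F)}"
  have "?S = card ` {F. F \<subseteq> E \<and> triangle_free (E - F)}" by auto
  then have fin: "finite ?S" using assms by simp
  have "triangle_free (E - E)" by (simp add: triangle_free_def is_triangle_def)
  then have "?S \<noteq> {}" by blast
  from Min_in[OF fin this] obtain F where "F \<subseteq> E" "triangle_free (E - F)" "card F = tau_t E"
    unfolding tau_t_def by auto
  moreover have "tau_t E \<le> card F'" if "F' \<subseteq> E" "triangle_free (E - F')" for F'
    unfolding tau_t_def using that by (intro Min_le[OF fin]) blast
  ultimately show ?thesis using that by blast
qed

lemma tau_t_star_attained:
  assumes "finite E"
  obtains f where "fractional_triangle_cover E f" "(\<Sum>e\<in>E. f e) = tau_t_star E"
    "\<And>g. fractional_triangle_cover E g \<Longrightarrow> tau_t_star E \<le> (\<Sum>e\<in>E. g e)"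
proof -
  define K where "K = (PiE UNIV (\<lambda>_::'a set. {0..1::real})) \<inter>
    (\<Inter>(x,y,z)\<in>{(x,y,z). is_triangle E x y z}. {f. f {x, y} + f {y, z} + f {x, z} \<ge> 1})"
  have "closed (\<Inter>(x,y,z)\<in>{(x,y,z). is_triangle E x y z}.
      {f :: 'a set \<Rightarrow> real. f {x, y} + f {y, z} + f {x, z} \<ge> 1})"
    by (intro closed_INT ballI)
       (auto intro!: closed_Collect_le continuous_intros continuous_on_product_coordinates)
  moreover have "compact (PiE UNIV (\<lambda>_::'a set. {0..1::real}))"
    using compactin_PiE[of "\<lambda>_. euclidean" "UNIV :: 'a set set" "\<lambda>_. {0..1::real}"]
    by (simp add: euclidean_product_topology)
  ultimately have "compact K" unfolding K_def
    by (intro compact_Int_closed)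
  moreover have "(\<lambda>_. 1) \<in> K" by (auto simp: K_def)
  then have "K \<noteq> {}" by blast
  moreover have "continuous_on K (\<lambda>f. \<Sum>e\<in>E. f e)"
    by (intro continuous_on_sum continuous_on_subset[OF continuous_on_product_coordinates subset_UNIV])
  ultimately obtain f where f: "f \<in> K" "\<And>g. g \<in> K \<Longrightarrow> (\<Sum>e\<in>E. f e) \<le> (\<Sum>e\<in>E. g e)"
    using continuous_attains_inf[of K "\<lambda>f. \<Sum>e\<in>E. f e"] by auto
  have cover: "fractional_triangle_cover E f"
    using f(1) by (auto simp: K_def fractional_triangle_cover_def PiE_def Pi_def)
  have least: "(\<Sum>e\<in>E. f e) \<le> (\<Sum>e\<in>E. g e)" if g: "fractional_triangle_cover E g" for g
  proof -
    define h where "h = (\<lambda>e. if e \<in> E then min 1 (g e) else 0)"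
    have "h {x, y} + h {y, z} + h {x, z} \<ge> 1" if t: "is_triangle E x y z" for x y z
    proof -
      have E: "{x, y} \<in> E" "{y, z} \<in> E" "{x, z} \<in> E" using t by (auto simp: is_triangle_def)
      have "0 \<le> g {x, y}" "0 \<le> g {y, z}" "0 \<le> g {x, z}"
        "g {x, y} + g {y, z} + g {x, z} \<ge> 1"
        using g t E by (auto simp: fractional_triangle_cover_def)
      then show ?thesis using E by (simp add: h_def min_def)
    qed
    then have "h \<in> K" using g
      by (auto simp: K_def h_def PiE_def Pi_def fractional_triangle_cover_def)
    then have "(\<Sum>e\<in>E. f e) \<le> (\<Sum>e\<in>E. h e)" by (rule f(2))
    also have "\<dots> \<le> (\<Sum>e\<in>E. g e)" by (intro sum_mono) (auto simp: h_def)
    finally show ?thesis .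
  qed
  have "tau_t_star E = (\<Sum>e\<in>E. f e)" unfolding tau_t_star_def
    by (rule cInf_eq_minimum) (use cover least in auto)
  then show ?thesis using that cover least by metis
qed

end

theory Submission
  imports Defs
begin

text \<open>
  Let \<open>f\<close> be an optimal fractional cover. Moving from \<open>f\<close> slightly away from a function \<open>h\<close> cannot
  decrease the total weight, so \<open>tau_t_star\<close> is at least the total weight of any \<open>h\<close> that vanishes
  where \<open>f\<close> does and has weight at most 1 on the tight triangles; this replaces LP duality.
  Suppose \<open>tau_t_star\<close> is close to \<open>m/4\<close> while \<open>tau_t\<close> is close to \<open>m/2\<close>. Two choices of \<open>h\<close> show
  that nearly \<open>m/4\<close> or more edges have \<open>f = 0\<close> and that only \<open>O(\<beta>\<^sup>2 m)\<close> edges, with a small constant,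
  have \<open>f \<ge> 1\<close>. All edges of \<open>G\<close> between two neighbours of a vertex \<open>v\<close> along edges with \<open>f = 0\<close>
  have \<open>f \<ge> 1\<close>, so this neighbourhood is almost independent; by density, for some \<open>v\<close> its degree sum
  is of order \<open>\<beta> m\<close>. Biasing a random cut against it gains order \<open>\<beta>\<^sup>2 m\<close> edges over \<open>m/2\<close>, which
  contradicts the lower bound on \<open>tau_t\<close>.
\<close>

section \<open>First-order perturbation of an optimal cover\<close>

lemma is_triangle_in_V:
  assumes "simple_graph V E" "is_triangle E x y z"
  shows "x \<in> V" "y \<in> V" "z \<in> V"
  using assms unfolding simple_graph_def is_triangle_def by blast+

text \<open>Along the segment \<open>f + t * (f - h)\<close>, constraints with slack at
  \<open>f\<close> survive for small \<open>t > 0\<close> by continuity. The hypotheses on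
  \<open>h\<close> say exactly that the tight constraints survive as well, so optimality of
  \<open>f\<close> makes the derivative of the total weight nonnegative.\<close>

lemma optimal_cover_dual_bound:
  assumes G: "simple_graph V E"
    and f: "fractional_triangle_cover E f"
    and opt: "\<And>g. fractional_triangle_cover E g \<Longrightarrow> (\<Sum>e\<in>E. f e) \<le> (\<Sum>e\<in>E. g e)"
    and h0: "\<And>e. e \<in> E \<Longrightarrow> f e = 0 \<Longrightarrow> h e \<le> 0"
    and hT: "\<And>x y z. is_triangle E x y z \<Longrightarrow> f {x, y} + f {y, z} + f {x, z} = 1 \<Longrightarrow>
               h {x, y} + h {y, z} + h {x, z} \<le> 1"
  shows "(\<Sum>e\<in>E. h e) \<le> (\<Sum>e\<in>E. f e)"
proof -
  define g where "g t e = f e + t * (f e - h e)" for t :: real and e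
  have lim: "((\<lambda>t. a + t * b) \<longlongrightarrow> a) (at_right 0)" for a b :: real
    by (auto intro!: tendsto_eq_intros)
  have pos: "\<forall>\<^sub>F t in at_right (0::real). t > 0"
    by (simp add: eventually_at_right_less)
  have "\<forall>\<^sub>F t in at_right 0. 0 \<le> g t e" if e: "e \<in> E" for e
  proof (cases "f e = 0")
    case True
    show ?thesis using pos
      by eventually_elim (use h0[OF e True] True in \<open>simp add: g_def mult_nonneg_nonpos\<close>)
  next
    case False
    then have "0 < f e" using f e by (force simp: fractional_triangle_cover_def)
    from order_tendstoD(1)[OF lim this, of "f e - h e"] show ?thesis
      by eventually_elim (simp add: g_def)
  qed
  then have ev1: "\<forall>\<^sub>F t in at_right 0. \<forall>e\<in>E. 0 \<le> g t e"
    by (intro eventually_ball_finite[OF finite_edges[OF G]] ballI)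
  \<comment> \<open>Finiteness of the set of triangles allows one common \<open>t\<close> for all
    constraints.\<close>
  define T where "T = {(x, y, z). is_triangle E x y z}"
  have "T \<subseteq> V \<times> V \<times> V" using is_triangle_in_V[OF G] by (auto simp: T_def)
  then have finT: "finite T"
    using G by (meson finite_SigmaI finite_subset simple_graph_def)
  have "\<forall>\<^sub>F t in at_right 0. g t {x, y} + g t {y, z} + g t {x, z} \<ge> 1"
    if t: "is_triangle E x y z" for x y z
  proof -
    define s where "s = f {x, y} + f {y, z} + f {x, z}"
    define r where "r = h {x, y} + h {y, z} + h {x, z}"
    have g: "g t {x, y} + g t {y, z} + g t {x, z} = s + t * (s - r)" for t
      by (simp add: g_def s_def r_def algebra_simps)
    have "s \<ge> 1" using f t by (auto simp: fractional_triangle_cover_def s_def)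
    then consider "s = 1" | "s > 1" by linarith
    then show ?thesis
    proof cases
      case 1
      then have "r \<le> 1" using hT[OF t] by (simp add: s_def r_def)
      show ?thesis unfolding g using pos
        by eventually_elim (use 1 \<open>r \<le> 1\<close> in simp)
    next
      case 2
      from order_tendstoD(1)[OF lim this, of "s - r"] show ?thesis unfolding g
        by eventually_elim simp
    qed
  qed
  then have ev2: "\<forall>\<^sub>F t in at_right 0. \<forall>(x, y, z)\<in>T. g t {x, y} + g t {y, z} + g t {x, z} \<ge> 1"
    by (intro eventually_ball_finite[OF finT]) (auto simp: T_def)
  obtain t where t: "t > 0" "\<forall>e\<in>E. 0 \<le> g t e"
    "\<forall>(x, y, z)\<in>T. g t {x, y} + g t {y, z} + g t {x, z} \<ge> 1"
    using eventually_happens[OF eventually_conj[OF pos eventually_conj[OF ev1 ev2]]] by auto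
  have "fractional_triangle_cover E (g t)"
    using t unfolding fractional_triangle_cover_def T_def by auto
  from opt[OF this] have "0 \<le> t * ((\<Sum>e\<in>E. f e) - (\<Sum>e\<in>E. h e))"
    by (simp add: g_def sum.distrib sum_subtractf flip: sum_distrib_left)
  then show ?thesis using t(1) by (simp add: zero_le_mult_iff)
qed

section \<open>Random cuts and roundings\<close>

text \<open>For a two-element \<open>e\<close>, this is the probability that its ends are separated
  when each \<open>v\<close> independently goes to side 1 with probability \<open>p v\<close>. Sum
  and product over the set avoid ordering the ends.\<close>

definition cut_weight :: "('a \<Rightarrow> real) \<Rightarrow> 'a set \<Rightarrow> real" where
  "cut_weight p e = sum p e - 2 * prod p e"

lemma cut_weight_pair: "x \<noteq> y \<Longrightarrow> cut_weight p {x, y} = p x + p y - 2 * p x * p y"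
  by (simp add: cut_weight_def)

lemma cut_weight_affine:
  assumes "card e = 2"
  shows "cut_weight p e = (1 - p v) * cut_weight (p(v := 0)) e + p v * cut_weight (p(v := 1)) e"
proof -
  obtain x y where "e = {x, y}" "x \<noteq> y" using assms by (auto simp: card_2_iff)
  then show ?thesis by (auto simp: cut_weight_pair algebra_simps)
qed

text \<open>Derandomization by conditional expectations: the expected size of a random cut is affine
  in the probability of each single vertex.\<close>

lemma exists_integral_cut:
  assumes "finite W" "\<And>e. e \<in> E \<Longrightarrow> card e = 2" "\<And>v. v \<in> W \<Longrightarrow> 0 \<le> p v \<and> p v \<le> 1"
  shows "\<exists>q. (\<forall>v\<in>W. q v \<in> {0, 1}) \<and> (\<forall>v. v \<notin> W \<longrightarrow> q v = p v) \<and>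
    (\<Sum>e\<in>E. cut_weight p e) \<le> (\<Sum>e\<in>E. cut_weight q e)"
  using assms(1,3)
proof (induction W arbitrary: p rule: finite_induct)
  case empty
  then show ?case by auto
next
  case (insert v W)
  define F where "F p = (\<Sum>e\<in>E. cut_weight p e)" for p :: "'a \<Rightarrow> real"
  have "F p = (1 - p v) * F (p(v := 0)) + p v * F (p(v := 1))"
    unfolding F_def sum_distrib_left sum.distrib[symmetric]
    by (intro sum.cong refl cut_weight_affine assms(2))
  moreover have "0 \<le> p v" "p v \<le> 1" using insert.prems by auto
  ultimately have "F p \<le> max (F (p(v := 0))) (F (p(v := 1)))"
    using convex_bound_le[of "F (p(v := 0))" "max (F (p(v := 0))) (F (p(v := 1)))"
        "F (p(v := 1))" "1 - p v" "p v"] by simp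
  then obtain b where b: "b \<in> {0, 1 :: real}" "F p \<le> F (p(v := b))"
    by (auto simp: max_def split: if_splits)
  have "0 \<le> (p(v := b)) u \<and> (p(v := b)) u \<le> 1" if "u \<in> W" for u
    using insert.prems insert.hyps that by auto
  from insert.IH[of "p(v := b)", OF this]
  obtain q where q: "\<forall>u\<in>W. q u \<in> {0, 1}" "\<forall>u. u \<notin> W \<longrightarrow> q u = (p(v := b)) u"
    "F (p(v := b)) \<le> F q"
    unfolding F_def by blast
  \<comment> \<open>The clause on vertices outside \<open>W\<close> preserves the value already
    fixed at \<open>v\<close>.\<close>
  have "q v = b" using q(2) insert.hyps by simp
  then show ?case using q b insert.hyps unfolding F_def
    by (intro exI[of _ q]) auto
qed

text \<open>A triangle crosses a cut an even number of times, so its three edges are never all cut.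
  The subset \<open>D\<close> is there so that only part of the edges may be cut, as the rounding of
  a cover requires.\<close>

lemma exists_large_cut:
  assumes G: "simple_graph V E" and D: "D \<subseteq> E"
    and p: "\<And>v. v \<in> V \<Longrightarrow> 0 \<le> p v \<and> p v \<le> 1"
  shows "\<exists>C\<subseteq>D. (\<forall>x y z. is_triangle D x y z \<longrightarrow> \<not> {{x, y}, {y, z}, {x, z}} \<subseteq> C) \<and>
    (\<Sum>e\<in>D. cut_weight p e) \<le> real (card C)"
proof -
  have finD: "finite D" using finite_edges[OF G] D finite_subset by blast
  have D2: "e \<subseteq> V \<and> card e = 2" if "e \<in> D" for e
    using that D G by (auto simp: simple_graph_def)
  obtain q where q: "\<forall>v\<in>V. q v \<in> {0, 1}"
    "(\<Sum>e\<in>D. cut_weight p e) \<le> (\<Sum>e\<in>D. cut_weight q e)"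
    using exists_integral_cut[of V D p] p D2 G by (auto simp: simple_graph_def)
  define C where "C = {e \<in> D. cut_weight q e = 1}"
  have w: "cut_weight q e = of_bool (e \<in> C)" if e: "e \<in> D" for e
  proof -
    obtain x y where xy: "e = {x, y}" "x \<noteq> y" using D2[OF e] by (auto simp: card_2_iff)
    then have "q x \<in> {0, 1}" "q y \<in> {0, 1}" using D2[OF e] q(1) by auto
    then show ?thesis using e xy by (auto simp: C_def cut_weight_pair)
  qed
  have "(\<Sum>e\<in>D. cut_weight q e) = (\<Sum>e\<in>D. of_bool (e \<in> C))"
    by (intro sum.cong refl w)
  also have "\<dots> = real (card (D \<inter> C))" using finD by (simp add: Int_def)
  also have "D \<inter> C = C" by (auto simp: C_def)
  finally have "(\<Sum>e\<in>D. cut_weight p e) \<le> real (card C)" using q(2) by simp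
  moreover have "\<not> {{x, y}, {y, z}, {x, z}} \<subseteq> C" if t: "is_triangle D x y z" for x y z
  proof
    assume "{{x, y}, {y, z}, {x, z}} \<subseteq> C"
    moreover have ne: "x \<noteq> y" "y \<noteq> z" "x \<noteq> z" using t by (auto simp: is_triangle_def)
    moreover have "q x \<in> {0, 1}" "q y \<in> {0, 1}" "q z \<in> {0, 1}"
      using q(1) D2 t unfolding is_triangle_def by blast+
    ultimately show False by (auto simp: C_def cut_weight_pair)
  qed
  ultimately show ?thesis by (intro exI[of _ C]) (auto simp: C_def)
qed

lemma tau_t_le:
  assumes "finite E" "F \<subseteq> E" "triangle_free (E - F)"
  shows "tau_t E \<le> card F"
  using tau_t_attained[OF assms(1)] assms(2,3) by metis

lemma tau_t_le_cut:
  assumes G: "simple_graph V E" and p: "\<And>v. v \<in> V \<Longrightarrow> 0 \<le> p v \<and> p v \<le> 1"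
  shows "real (tau_t E) \<le> real (card E) - (\<Sum>e\<in>E. cut_weight p e)"
proof -
  obtain C where C: "C \<subseteq> E" "\<forall>x y z. is_triangle E x y z \<longrightarrow> \<not> {{x, y}, {y, z}, {x, z}} \<subseteq> C"
    "(\<Sum>e\<in>E. cut_weight p e) \<le> real (card C)"
    using exists_large_cut[OF G order_refl, of p] p by auto
  have "triangle_free (E - (E - C))"
    using C(2) by (auto simp: triangle_free_def is_triangle_def)
  then have "tau_t E \<le> card (E - C)"
    by (intro tau_t_le finite_edges[OF G]) auto
  also have "real (card (E - C)) = real (card E) - real (card C)"
    using C(1) finite_edges[OF G] by (simp add: card_Diff_subset finite_subset card_mono of_nat_diff)
  finally show ?thesis using C(3) by linarith
qed

text \<open>Krivelevich's bound \<open>tau_t \<le> 2 tau_t_star\<close> comes from the same rounding: delete all edges of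
  weight at least \<open>1/2\<close>, and make the remaining edges of positive weight bipartite.\<close>

lemma tau_t_le_rounding:
  assumes G: "simple_graph V E" and f: "fractional_triangle_cover E f"
  shows "real (tau_t E) \<le> card {e\<in>E. 1/2 \<le> f e} + card {e\<in>E. 0 < f e \<and> f e < 1/2} / 2"
proof -
  define M where "M = {e\<in>E. 0 < f e \<and> f e < 1/2}"
  define H where "H = {e\<in>E. 1/2 \<le> f e}"
  have finE: "finite E" by (rule finite_edges[OF G])
  then have finM: "finite M" by (simp add: M_def)
  obtain C where C: "C \<subseteq> M" "\<forall>x y z. is_triangle M x y z \<longrightarrow> \<not> {{x, y}, {y, z}, {x, z}} \<subseteq> C"
    "(\<Sum>e\<in>M. cut_weight (\<lambda>_. 1/2) e) \<le> real (card C)"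
    using exists_large_cut[OF G, of M "\<lambda>_. 1/2"] by (auto simp: M_def)
  have "(\<Sum>e\<in>M. cut_weight (\<lambda>_. 1/2) e) = (\<Sum>e\<in>M. 1/2)"
    by (intro sum.cong refl) (use G in \<open>auto simp: M_def simple_graph_def cut_weight_def power2_eq_square\<close>)
  then have C2: "real (card M) / 2 \<le> card C" using C(3) by simp
  have "triangle_free (E - (H \<union> (M - C)))"
    unfolding triangle_free_def
  proof safe
    fix x y z assume t: "is_triangle (E - (H \<union> (M - C))) x y z"
    then have "is_triangle E x y z" by (auto simp: is_triangle_def)
    then have s: "f {x, y} + f {y, z} + f {x, z} \<ge> 1"
      using f by (auto simp: fractional_triangle_cover_def)
    have "f {x, y} < 1/2" "f {y, z} < 1/2" "f {x, z} < 1/2"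
      using t by (auto simp: is_triangle_def H_def)
    \<comment> \<open>Two values below \<open>1/2\<close> sum to less than 1, so the third must be
      positive.\<close>
    with s have "f {x, y} > 0" "f {y, z} > 0" "f {x, z} > 0" by linarith+
    with t have "is_triangle M x y z" "{{x, y}, {y, z}, {x, z}} \<subseteq> C"
      by (auto simp: is_triangle_def M_def H_def)
    with C(2) show False by blast
  qed
  then have "tau_t E \<le> card (H \<union> (M - C))"
    by (intro tau_t_le[OF finE]) (auto simp: H_def M_def)
  also have "\<dots> \<le> card H + card (M - C)" by (rule card_Un_le)
  finally have "real (tau_t E) \<le> real (card H) + real (card (M - C))" by linarith
  moreover have "real (card (M - C)) = real (card M) - real (card C)"
    using C(1) finM by (simp add: card_Diff_subset finite_subset card_mono of_nat_diff)
  ultimately show ?thesis using C2 by (simp add: M_def H_def)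
qed

section \<open>Two test functions for the dual bound\<close>

lemma optimal_cover_ge_third:
  assumes G: "simple_graph V E" and f: "fractional_triangle_cover E f"
    and opt: "\<And>g. fractional_triangle_cover E g \<Longrightarrow> (\<Sum>e\<in>E. f e) \<le> (\<Sum>e\<in>E. g e)"
  shows "real (card {e\<in>E. f e > 0}) / 3 \<le> (\<Sum>e\<in>E. f e)"
proof -
  have "(\<Sum>e\<in>E. of_bool (f e > 0) / 3) \<le> (\<Sum>e\<in>E. f e)"
    by (rule optimal_cover_dual_bound[OF G f opt]) auto
  then show ?thesis
    using finite_edges[OF G] by (simp add: Int_def flip: sum_divide_distrib)
qed

text \<open>The left side is half of the rounding bound on \<open>tau_t\<close> plus half the number
  of edges with \<open>f\<close> at least 1. Together the two bounds make that number at most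
  \<open>2 * tau_t_star E - tau_t E\<close>.\<close>

lemma optimal_cover_ge_rounding:
  assumes G: "simple_graph V E" and f: "fractional_triangle_cover E f"
    and opt: "\<And>g. fractional_triangle_cover E g \<Longrightarrow> (\<Sum>e\<in>E. f e) \<le> (\<Sum>e\<in>E. g e)"
  shows "card {e\<in>E. 1 \<le> f e} / 2 + card {e\<in>E. 1/2 \<le> f e} / 2
    + card {e\<in>E. 0 < f e \<and> f e < 1/2} / 4 \<le> (\<Sum>e\<in>E. f e)"
proof -
  define \<phi> :: "real \<Rightarrow> real" where
    "\<phi> a = of_bool (1 \<le> a) / 2 + of_bool (1/2 \<le> a) / 2 + of_bool (0 < a \<and> a < 1/2) / 4" for a
  \<comment> \<open>The values of \<phi> are 0, 1/4, 1/2 and 1. On a tight triangle a value 1 forces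
    two zeros, and two values 1/2 force a zero; in all other cases the total is at most 1/2 + 1/4 +
    1/4.\<close>
  have tight: "\<phi> a + \<phi> b + \<phi> c \<le> 1" if "a \<ge> 0" "b \<ge> 0" "c \<ge> 0" "a + b + c = 1" for a b c
    using that by (auto simp: \<phi>_def of_bool_def)
  have "(\<Sum>e\<in>E. \<phi> (f e)) \<le> (\<Sum>e\<in>E. f e)"
  proof (rule optimal_cover_dual_bound[OF G f opt])
    fix x y z assume t: "is_triangle E x y z" and "f {x, y} + f {y, z} + f {x, z} = 1"
    then show "\<phi> (f {x, y}) + \<phi> (f {y, z}) + \<phi> (f {x, z}) \<le> 1"
      using f by (intro tight) (auto simp: is_triangle_def fractional_triangle_cover_def)
  qed (auto simp: \<phi>_def)
  then show ?thesis
    using finite_edges[OF G]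
    by (simp add: \<phi>_def sum.distrib Int_def flip: sum_divide_distrib)
qed

section \<open>Degrees and a vertex whose \<open>Z\<close>-neighbourhood has large degree
  sum\<close>

definition nbrs :: "'a set set \<Rightarrow> 'a \<Rightarrow> 'a set" where
  "nbrs E v = {u. u \<noteq> v \<and> {u, v} \<in> E}"

definition deg :: "'a set set \<Rightarrow> 'a \<Rightarrow> nat" where
  "deg E v = card {e\<in>E. v \<in> e}"

lemma nbrs_subset: "simple_graph V E \<Longrightarrow> nbrs E v \<subseteq> V"
  by (auto simp: nbrs_def simple_graph_def)

lemma card_nbrs:
  assumes G: "simple_graph V E"
  shows "card (nbrs E v) = deg E v"
proof -
  have "{e\<in>E. v \<in> e} = (\<lambda>u. {u, v}) ` nbrs E v"
  proof (intro equalityI subsetI)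
    fix e assume e: "e \<in> {e\<in>E. v \<in> e}"
    then have "card e = 2" using G by (auto simp: simple_graph_def)
    then obtain x y where "e = {x, y}" "x \<noteq> y" by (auto simp: card_2_iff)
    with e show "e \<in> (\<lambda>u. {u, v}) ` nbrs E v"
      by (auto simp: nbrs_def image_iff insert_commute)
  qed (auto simp: nbrs_def)
  moreover have "inj_on (\<lambda>u. {u, v}) (nbrs E v)"
    by (auto simp: inj_on_def doubleton_eq_iff)
  ultimately show ?thesis by (simp add: deg_def card_image)
qed

lemma sum_deg:
  assumes G: "simple_graph V E" and S: "finite S"
  shows "(\<Sum>v\<in>S. deg E v) = (\<Sum>e\<in>E. card (e \<inter> S))"
proof -
  have "(\<Sum>v\<in>S. deg E v) = (\<Sum>v\<in>S. \<Sum>e\<in>E. of_bool (v \<in> e))"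
    using finite_edges[OF G] by (simp add: deg_def Int_def)
  also have "\<dots> = (\<Sum>e\<in>E. \<Sum>v\<in>S. of_bool (v \<in> e))" by (rule sum.swap)
  also have "\<dots> = (\<Sum>e\<in>E. card (e \<inter> S))"
    using S by (simp add: Int_def conj_commute)
  finally show ?thesis .
qed

lemma handshake:
  assumes G: "simple_graph V E"
  shows "(\<Sum>v\<in>V. deg E v) = 2 * card E"
proof -
  have "(\<Sum>v\<in>V. deg E v) = (\<Sum>e\<in>E. card (e \<inter> V))"
    using G by (intro sum_deg) (auto simp: simple_graph_def)
  also have "\<dots> = (\<Sum>e\<in>E. 2)"
    using G by (intro sum.cong refl) (auto simp: simple_graph_def Int_absorb2)
  finally show ?thesis by simp
qed

lemma card_edges_le:
  assumes G: "simple_graph V E"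
  shows "2 * card E \<le> (card V)\<^sup>2"
proof -
  have "2 * card E = (\<Sum>v\<in>V. card (nbrs E v))"
    using handshake[OF G] card_nbrs[OF G] by simp
  also have "\<dots> \<le> (\<Sum>v\<in>V. card V)"
    using G nbrs_subset[OF G] by (intro sum_mono card_mono) (auto simp: simple_graph_def)
  finally show ?thesis by (simp add: power2_eq_square)
qed

text \<open>Summed over all \<open>v\<close>, the inner sums count each \<open>u\<close> exactly
  \<open>deg Z u\<close> times, giving at least the sum of squares of the \<open>Z\<close>-degrees.
  Cauchy-Schwarz costs one factor \<open>card V\<close>, and averaging over \<open>v\<close> the
  other.\<close>

lemma exists_vertex_nbrs_deg_sum:
  assumes G: "simple_graph V E" and Z: "Z \<subseteq> E" and V: "V \<noteq> {}"
  obtains v where "v \<in> V"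
    "(2 * real (card Z))\<^sup>2 \<le> (real (card V))\<^sup>2 * (\<Sum>u\<in>nbrs Z v. real (deg E u))"
proof -
  have finV: "finite V" using G by (simp add: simple_graph_def)
  have GZ: "simple_graph V Z" using G Z by (auto simp: simple_graph_def)
  define Q where "Q v = (\<Sum>u\<in>nbrs Z v. real (deg E u))" for v
  have "(\<Sum>v\<in>V. Q v) = (\<Sum>v\<in>V. \<Sum>u\<in>V. if u \<in> nbrs Z v then real (deg E u) else 0)"
    using nbrs_subset[OF GZ] finV unfolding Q_def
    by (intro sum.cong[OF refl]) (simp add: sum.inter_restrict[symmetric] Int_absorb1)
  also have "\<dots> = (\<Sum>u\<in>V. \<Sum>v\<in>V. if v \<in> nbrs Z u then real (deg E u) else 0)"
    by (subst sum.swap) (simp add: nbrs_def insert_commute eq_commute cong: conj_cong)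
  also have "\<dots> = (\<Sum>u\<in>V. real (deg Z u) * real (deg E u))"
    using nbrs_subset[OF GZ] finV
    by (intro sum.cong[OF refl])
       (simp add: sum.inter_restrict[symmetric] Int_absorb1 card_nbrs[OF GZ])
  also have "\<dots> \<ge> (\<Sum>u\<in>V. (real (deg Z u))\<^sup>2)"
    unfolding power2_eq_square deg_def using Z finite_edges[OF G]
    by (intro sum_mono mult_left_mono of_nat_mono card_mono) auto
  finally have 1: "(\<Sum>u\<in>V. (real (deg Z u))\<^sup>2) \<le> (\<Sum>v\<in>V. Q v)" .
  have "(2 * real (card Z))\<^sup>2 = (\<Sum>u\<in>V. real (deg Z u))\<^sup>2"
    using handshake[OF GZ] by (metis of_nat_mult of_nat_numeral of_nat_sum)
  also have "\<dots> \<le> card V * (\<Sum>u\<in>V. (real (deg Z u))\<^sup>2)"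
    using sum_squared_le_sum_of_squares[of "\<lambda>u. real (deg Z u)" V] by (simp add: mult.commute)
  also have "\<dots> \<le> card V * (\<Sum>v\<in>V. Q v)" using 1 by (intro mult_left_mono) auto
  also have "(\<Sum>v\<in>V. Q v) \<le> card V * Max (Q ` V)"
    by (rule sum_bounded_above) (use finV in auto)
  finally have "(2 * real (card Z))\<^sup>2 \<le> (real (card V))\<^sup>2 * Max (Q ` V)"
    by (simp add: power2_eq_square mult_left_mono)
  moreover have "Max (Q ` V) \<in> Q ` V" using finV V by (intro Max_in) auto
  ultimately show ?thesis using that unfolding Q_def by auto
qed

text \<open>The cut puts \<open>S\<close> on one side and every other vertex on the opposite side with probability
  \<open>1/2 + x\<close>. For an almost independent set \<open>S\<close> the gain is linear in \<open>x\<close>, the loss quadratic.\<close>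

lemma tau_t_le_biased_cut:
  fixes x :: real
  assumes G: "simple_graph V E" and S: "S \<subseteq> V" and x: "0 \<le> x" "x \<le> 1/2"
  shows "real (tau_t E) \<le> (1/2 + 2 * x\<^sup>2) * card E - x * (\<Sum>u\<in>S. real (deg E u))
           + (1/2 + 2 * x) * card {e\<in>E. e \<subseteq> S}"
proof -
  have finE: "finite E" by (rule finite_edges[OF G])
  have finS: "finite S" using G S finite_subset by (auto simp: simple_graph_def)
  define p where "p v = (if v \<in> S then 0 else 1/2 + x)" for v
  \<comment> \<open>Equality holds when \<open>e\<close> misses \<open>S\<close>. With one end in
    \<open>S\<close> the true value is \<open>1/2 + x\<close>; with both ends it is 0, and the last
    term on the left compensates.\<close>
  have edge: "1/2 - 2 * x\<^sup>2 + x * card (e \<inter> S) - (1/2 + 2 * x) * of_bool (e \<subseteq> S) \<le> cut_weight p e"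
    if "e \<in> E" for e
  proof -
    have "card e = 2" using that G by (auto simp: simple_graph_def)
    then obtain a b where ab: "e = {a, b}" "a \<noteq> b" by (auto simp: card_2_iff)
    have "0 \<le> x * x" by simp
    then show ?thesis using ab x
      by (cases "a \<in> S"; cases "b \<in> S")
         (auto simp: cut_weight_pair p_def power2_eq_square algebra_simps)
  qed
  have "(\<Sum>e\<in>E. 1/2 - 2 * x\<^sup>2 + x * card (e \<inter> S) - (1/2 + 2 * x) * of_bool (e \<subseteq> S))
      = (1/2 - 2 * x\<^sup>2) * card E + x * (\<Sum>e\<in>E. real (card (e \<inter> S)))
        - (1/2 + 2 * x) * card {e\<in>E. e \<subseteq> S}"
    using finE by (simp add: sum.distrib sum_subtractf Int_def mult.commute flip: sum_distrib_left)
  also have "(\<Sum>e\<in>E. real (card (e \<inter> S))) = (\<Sum>u\<in>S. real (deg E u))"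
    using sum_deg[OF G finS] by (metis of_nat_sum)
  finally have "(1/2 - 2 * x\<^sup>2) * card E + x * (\<Sum>u\<in>S. real (deg E u))
        - (1/2 + 2 * x) * card {e\<in>E. e \<subseteq> S} \<le> (\<Sum>e\<in>E. cut_weight p e)"
    using sum_mono[of E, OF edge, of "\<lambda>e. e"] by simp
  moreover have "real (tau_t E) \<le> real (card E) - (\<Sum>e\<in>E. cut_weight p e)"
    using x by (intro tau_t_le_cut[OF G]) (auto simp: p_def)
  ultimately show ?thesis by (simp add: algebra_simps)
qed

section \<open>Combining the estimates\<close>

lemma tau_t_star_ge_of_tau_t_ge:
  fixes \<beta> :: real
  assumes \<beta>: "\<beta> > 0" and G: "simple_graph V E" and V: "card V > 0"
    and dense: "real (card E) \<ge> \<beta> * (real (card V))\<^sup>2"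
    and tau: "real (tau_t E) \<ge> (1 - \<beta>\<^sup>2 / 800) * (real (card E) / 2)"
  shows "tau_t_star E \<ge> (1 + \<beta>\<^sup>2 / 800) * (real (card E) / 4)"
proof (rule ccontr)
  define m n where "m = real (card E)" and "n = real (card V)"
  assume "\<not> ?thesis"
  then have less: "tau_t_star E < (1 + \<beta>\<^sup>2 / 800) * (m / 4)" by (simp add: m_def)
  have finE: "finite E" by (rule finite_edges[OF G])
  obtain f where f: "fractional_triangle_cover E f" "(\<Sum>e\<in>E. f e) = tau_t_star E"
    and opt: "\<And>g. fractional_triangle_cover E g \<Longrightarrow> (\<Sum>e\<in>E. f e) \<le> (\<Sum>e\<in>E. g e)"
    using tau_t_star_attained[OF finE] by metis
  have n: "n > 0" using V by (simp add: n_def)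
  have m: "m \<ge> \<beta> * n\<^sup>2" using dense by (simp add: m_def n_def)
  with \<beta> n have m0: "m > 0" by (meson less_le_trans mult_pos_pos zero_less_power)
  have "2 * m \<le> n\<^sup>2" using card_edges_le[OF G] unfolding m_def n_def
    by (metis of_nat_le_iff of_nat_mult of_nat_numeral of_nat_power)
  with m have "\<beta> * n\<^sup>2 \<le> 1/2 * n\<^sup>2" by simp
  with n have \<beta>2: "\<beta> \<le> 1/2" by simp
  then have \<beta>sq: "\<beta>\<^sup>2 \<le> 1/4" using power_mono[of \<beta> "1/2" 2] \<beta> by (simp add: power2_eq_square)
  define Z where "Z = {e\<in>E. f e = 0}"
  define A where "A = {e\<in>E. 1 \<le> f e}"
  \<comment> \<open>Here \<open>card A\<close> is at most \<open>2 * tau_t_star E - tau_t E\<close>,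
    where the main terms \<open>m/2\<close> cancel.\<close>
  have A: "real (card A) \<le> \<beta>\<^sup>2 / 800 * m"
    using tau_t_le_rounding[OF G f(1)] optimal_cover_ge_rounding[OF G f(1) opt] tau less f(2)
    by (simp add: A_def m_def field_simps)
  have "Z = E - {e\<in>E. f e > 0}"
    using f(1) by (force simp: Z_def fractional_triangle_cover_def)
  then have "real (card Z) = m - card {e\<in>E. f e > 0}"
    using finE by (simp add: m_def card_Diff_subset card_mono of_nat_diff)
  \<comment> \<open>At most \<open>3 * tau_t_star E\<close> edges have positive weight.\<close>
  then have "real (card Z) \<ge> m / 4 - 3/3200 * (\<beta>\<^sup>2 * m)"
    using optimal_cover_ge_third[OF G f(1) opt] less f(2)
    by (simp add: algebra_simps)
  moreover have "\<beta>\<^sup>2 * m \<le> 1/4 * m" using \<beta>sq m0 by (intro mult_right_mono) auto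
  ultimately have Z: "2 * real (card Z) \<ge> 498/1000 * m" using m0 by linarith
  have "Z \<subseteq> E" "V \<noteq> {}" using V by (auto simp: Z_def)
  from exists_vertex_nbrs_deg_sum[OF G this]
  obtain v where v: "v \<in> V" "(2 * real (card Z))\<^sup>2 \<le> n\<^sup>2 * (\<Sum>u\<in>nbrs Z v. real (deg E u))"
    unfolding n_def by blast
  define Q where "Q = (\<Sum>u\<in>nbrs Z v. real (deg E u))"
  \<comment> \<open>Density trades the factor \<open>n\<^sup>2\<close> for \<open>m\<close>; the
    square of 0.498 is 0.248004.\<close>
  have "n\<^sup>2 * (248/1000 * \<beta> * m) = 248/1000 * m * (\<beta> * n\<^sup>2)" by simp
  also have "\<dots> \<le> 248/1000 * m * m" using m m0 by (intro mult_left_mono) auto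
  also have "\<dots> \<le> (498/1000 * m)\<^sup>2" using m0 by (simp add: power2_eq_square)
  also have "\<dots> \<le> (2 * real (card Z))\<^sup>2" using Z m0 by (intro power_mono) auto
  also have "\<dots> \<le> n\<^sup>2 * Q" using v(2) by (simp add: Q_def)
  finally have Q: "248/1000 * \<beta> * m \<le> Q" using n by simp
  have "{e\<in>E. e \<subseteq> nbrs Z v} \<subseteq> A"
  proof safe
    fix e assume e: "e \<in> E" "e \<subseteq> nbrs Z v"
    then have "card e = 2" using G by (auto simp: simple_graph_def)
    then obtain a b where ab: "e = {a, b}" "a \<noteq> b" by (auto simp: card_2_iff)
    then have "f {a, v} = 0" "f {b, v} = 0" "is_triangle E a b v"
      using e by (auto simp: nbrs_def Z_def is_triangle_def)
    then show "e \<in> A" using f(1) e(1) ab by (force simp: fractional_triangle_cover_def A_def)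
  qed
  then have "card {e\<in>E. e \<subseteq> nbrs Z v} \<le> card A"
    using finE by (intro card_mono) (auto simp: A_def)
  then have inner: "real (card {e\<in>E. e \<subseteq> nbrs Z v}) \<le> \<beta>\<^sup>2 / 800 * m" using A by linarith
  have S: "nbrs Z v \<subseteq> V" using nbrs_subset[OF G] by (auto simp: nbrs_def Z_def)
  \<comment> \<open>The gain 0.248 \<beta> x m minus the loss 2 x^2 m is largest at x = 0.062
    \<beta>, and \<beta>/16 is a convenient value nearby.\<close>
  have "real (tau_t E) \<le> (1/2 + 2 * (\<beta>/16)\<^sup>2) * m - \<beta>/16 * Q
      + (1/2 + 2 * (\<beta>/16)) * card {e\<in>E. e \<subseteq> nbrs Z v}"
    using tau_t_le_biased_cut[OF G S, of "\<beta>/16"] \<beta> \<beta>2 by (simp add: m_def Q_def)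
  also have "\<dots> \<le> (1/2 + 2 * (\<beta>/16)\<^sup>2) * m - \<beta>/16 * (248/1000 * \<beta> * m) + 1 * (\<beta>\<^sup>2 / 800 * m)"
    using Q inner \<beta> \<beta>2 by (intro add_mono diff_mono mult_left_mono mult_mono) auto
  also have "\<dots> = m / 2 - (248/16000 - 2/256 - 1/800) * (\<beta>\<^sup>2 * m)"
    by (simp add: power2_eq_square algebra_simps)
  finally have "real (tau_t E) \<le> m / 2 - (248/16000 - 2/256 - 1/800) * (\<beta>\<^sup>2 * m)" .
  moreover have "0 < \<beta>\<^sup>2 * m" using \<beta> m0 by simp
  \<comment> \<open>The coefficient of \<open>\<beta>\<^sup>2 * m\<close> is 0.0064375, while the
    assumption on \<open>tau_t\<close> permits a deficit of only 1/1600.\<close>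
  ultimately show False using tau by (simp add: m_def algebra_simps)
qed

theorem theorem2p1:
  shows "\<forall>\<beta>::real. \<beta> > 0 \<longrightarrow> (\<exists>(N::nat) (\<delta>::real). \<delta> > 0 \<and>
    (\<forall>(V :: 'a set) (E :: 'a set set).
       simple_graph V E \<and> card V > N \<and> real (card E) \<ge> \<beta> * (real (card V))^2 \<and>
       real (tau_t E) \<ge> (1 - \<delta>) * (real (card E) / 2) \<longrightarrow>
       tau_t_star E \<ge> (1 + \<beta>^2 / 800) * (real (card E) / 4)))"
proof (intro allI impI)
  fix \<beta> :: real assume "\<beta> > 0"
  then show "\<exists>(N::nat) (\<delta>::real). \<delta> > 0 \<and>
    (\<forall>(V :: 'a set) (E :: 'a set set).
       simple_graph V E \<and> card V > N \<and> real (card E) \<ge> \<beta> * (real (card V))^2 \<and>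
       real (tau_t E) \<ge> (1 - \<delta>) * (real (card E) / 2) \<longrightarrow>
       tau_t_star E \<ge> (1 + \<beta>^2 / 800) * (real (card E) / 4))"
    \<comment> \<open>The estimates hold for every nonempty vertex set, hence the witness 0 for
      \<open>N\<close>.\<close>
    by (intro exI[of _ "0::nat"] exI[of _ "\<beta>\<^sup>2 / 800"] conjI allI impI)
       (simp, elim conjE, rule tau_t_star_ge_of_tau_t_ge)
qed

end
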